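(* Let $F_k:\mathbb{R}^n\to\mathcal{I}$ ($k\in K:=\{1,\dots,m\}$) and $g_j:\mathbb{R}^n\to\mathbb{R}$ ($j\in J:=\{1,\dots,p\}$) be locally Lipschitz continuous, $F=(F_1,\dots,F_m)$, $S:=\{u\in\mathbb{R}^n:g_j(u)\le0,\ \forall j\in J\}$. Let $\varepsilon=(\varepsilon_1,\dots,\varepsilon_m)\in\mathbb{R}^m_+\setminus\{0\}$ and $\overline{u}\in QM(F,S,\varepsilon)$. Assume that BCQ holds at $\overline{u}\in S$. Then there exist $\lambda\in\mathbb{R}^m_+$ with $\sum_{k\in K}\lambda_k=1$ and $\mu\in\mathbb{R}^p_+$ such that $$0\in\sum_{k\in K}\lambda_k\partial^0 F_k(\overline{u})+\sum_{j\in I(\overline{u})}\mu_j\partial^0 g_j(\overline{u})+\sum_{k\in K}\lambda_k\varepsilon_k \mathbb{B}^n,\qquad \mu_jg_j(\overline{u})=0\ \ \forall j\in J.$$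
   Context: $\mathcal{I}$ is the set of all compact intervals $[\underline q,\overline q]$ with $\underline q\le\overline q$ real. For $Q=[\underline q,\overline q]\in\mathcal I$ put $q^c=\frac{\underline q+\overline q}{2}$ and $q^w=\frac{\overline q-\underline q}{2}$. Addition: $[\underline q,\overline q]+[\underline r,\overline r]=[\underline q+\underline r,\overline q+\overline r]$. Order: $Q\prec_{CW}R$ iff $q^c<r^c$ and $q^w<r^w$. $\mathbb{R}^m_+$ is the nonnegative orthant; $\mathbb{B}^n$ is the closed unit ball of $\mathbb{R}^n$; $\mathrm{co}$ denotes convex hull. An interval-valued function $f=[\underline f,\overline f]:\mathbb{R}^n\to\mathcal I$ is locally Lipschitz continuous if every point has a neighbourhood $U$ and $L>0$ with $\max\{|\underline f(u_1)-\underline f(u_2)|,|\overline f(u_1)-\overline f(u_2)|\}\le L\|u_1-u_2\|$ for $u_1,u_2\in U$ (equivalently, $\underline f,\overline f$ are locally Lipschitz). Write $f^c=\frac{\underline f+\overline f}{2}$, $f^w=\frac{\overline f-\underline f}{2}$. For locally Lipschitz $\psi:\mathbb{R}^n\to\mathbb{R}$, $\psi^0(z;w)=\limsup_{u\to z,\,t\to0^+}\frac{\psi(u+tw)-\psi(u)}{t}$ and $\partial^0\psi(z)=\{z^*\in\mathbb{R}^n:\langle z^*,w\rangle\le\psi^0(z;w)\ \forall w\}$ (Clarke gradient). For a locally Lipschitz interval-valued $f$, the weakly generalized gradient is $\partial^0f(u):=\mathrm{co}(\partial^0f^c(u)\cup\partial^0f^w(u))$. $QM(F,S,\varepsilon)$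 (weak $\varepsilon$-quasi-minimal solutions) is the set of $z_0\in S$ for which there is no $z\in S$ with $F_k(z)+[0,\varepsilon_k\|z-z_0\|]\prec_{CW}F_k(z_0)$ for all $k\in K$. For $u\in S$, $I(u):=\{j\in J:g_j(u)=0\}$. BCQ holds at $u\in S$ if there is no $\mu\in\mathbb{R}^p_+\setminus\{0\}$ with $\mu_j\ge 0$ for $j\in I(u)$, $\mu_j=0$ for $j\notin I(u)$ and $0\in\sum_{j\in J}\mu_j\partial^0g_j(u)$. A sum over an empty index set is $\{0\}$. *)

theory Defs
  imports "HOL-Analysis.Analysis" "HOL-Library.Interval" "HOL-Library.Set_Algebras"
begin

definition centre :: "real interval \<Rightarrow> real" where
  "centre Q = (lower Q + upper Q) / 2"

definition half_width :: "real interval \<Rightarrow> real" where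
  "half_width Q = (upper Q - lower Q) / 2"

(* The order classes already provided on intervals are inclusion; the centre-width
   order is a separate relation. *)
definition cw_less :: "real interval \<Rightarrow> real interval \<Rightarrow> bool"  (infix \<open>\<prec>\<^sub>C\<^sub>W\<close> 50) where
  "Q \<prec>\<^sub>C\<^sub>W R \<longleftrightarrow> centre Q < centre R \<and> half_width Q < half_width R"

definition loc_lipschitz :: "('a::euclidean_space \<Rightarrow> real) \<Rightarrow> bool" where
  "loc_lipschitz \<psi> \<longleftrightarrow> (\<forall>z. \<exists>U L. open U \<and> z \<in> U \<and> 0 < L \<and> L-lipschitz_on U \<psi>)"

definition loc_lipschitz_ivl :: "('a::euclidean_space \<Rightarrow> real interval) \<Rightarrow> bool" where
  "loc_lipschitz_ivl f \<longleftrightarrow>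
     (\<forall>z. \<exists>U L. open U \<and> z \<in> U \<and> 0 < L \<and>
        (\<forall>u1\<in>U. \<forall>u2\<in>U.
           max \<bar>lower (f u1) - lower (f u2)\<bar> \<bar>upper (f u1) - upper (f u2)\<bar>
             \<le> L * norm (u1 - u2)))"

(* Limit superior as u tends to z (u = z allowed) and t tends to 0 from the right, jointly.
   It is formed in the extended reals; for locally Lipschitz functions it is finite. *)
definition clarke_deriv :: "('a::euclidean_space \<Rightarrow> real) \<Rightarrow> 'a \<Rightarrow> 'a \<Rightarrow> ereal" where
  "clarke_deriv \<psi> z w =
     Limsup (nhds z \<times>\<^sub>F at_right 0) (\<lambda>(u, t). ereal ((\<psi> (u + t *\<^sub>R w) - \<psi> u) / t))"

definition clarke_grad :: "('a::euclidean_space \<Rightarrow> real) \<Rightarrow> 'a \<Rightarrow> 'a set" where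
  "clarke_grad \<psi> z = {v. \<forall>w. ereal (v \<bullet> w) \<le> clarke_deriv \<psi> z w}"

definition weak_gen_grad :: "('a::euclidean_space \<Rightarrow> real interval) \<Rightarrow> 'a \<Rightarrow> 'a set" where
  "weak_gen_grad f u =
     convex hull (clarke_grad (\<lambda>x. centre (f x)) u \<union> clarke_grad (\<lambda>x. half_width (f x)) u)"

definition scale_set :: "real \<Rightarrow> 'a::real_vector set \<Rightarrow> 'a set"  (infixr \<open>*\<^sub>S\<close> 75) where
  "c *\<^sub>S A = (\<lambda>x. c *\<^sub>R x) ` A"

definition feasible_set :: "nat set \<Rightarrow> (nat \<Rightarrow> 'a::euclidean_space \<Rightarrow> real) \<Rightarrow> 'a set" where
  "feasible_set J g = {u. \<forall>j\<in>J. g j u \<le> 0}"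

definition active_set :: "nat set \<Rightarrow> (nat \<Rightarrow> 'a::euclidean_space \<Rightarrow> real) \<Rightarrow> 'a \<Rightarrow> nat set" where
  "active_set J g u = {j \<in> J. g j u = 0}"

(* Interval (0, r) is the interval [0, r] only for r \<ge> 0, so this is meant for
   tolerances that are nonnegative on K. *)
definition weak_quasi_minimal ::
    "nat set \<Rightarrow> (nat \<Rightarrow> 'a::euclidean_space \<Rightarrow> real interval) \<Rightarrow> 'a set \<Rightarrow> (nat \<Rightarrow> real) \<Rightarrow> 'a set"
  where
  "weak_quasi_minimal K F S \<epsilon> =
     {z0 \<in> S. \<not> (\<exists>z\<in>S. \<forall>k\<in>K. F k z + Interval (0, \<epsilon> k * norm (z - z0)) \<prec>\<^sub>C\<^sub>W F k z0)}"

(* Sums of sets are Minkowski sums, with value {0} over an empty index set. *)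
definition BCQ :: "nat set \<Rightarrow> (nat \<Rightarrow> 'a::euclidean_space \<Rightarrow> real) \<Rightarrow> 'a \<Rightarrow> bool" where
  "BCQ J g u \<longleftrightarrow>
     \<not> (\<exists>\<mu>::nat \<Rightarrow> real. (\<forall>j\<in>J. 0 \<le> \<mu> j) \<and> (\<exists>j\<in>J. \<mu> j \<noteq> 0) \<and>
          (\<forall>j\<in>J - active_set J g u. \<mu> j = 0) \<and>
          0 \<in> (\<Sum>j\<in>J. \<mu> j *\<^sub>S clarke_grad (g j) u))"

end

theory Submission
  imports Defs
begin

text \<open>The Clarke derivative is a finite sublinear function, hence by separation it is the support
  function of the Clarke gradient. Let \<open>E\<^sub>k\<close> be the weakly generalized gradient of \<open>F\<^sub>k\<close> thickened
  by the ball of radius \<open>\<epsilon>\<^sub>k / 2\<close> (the centre and the half-width of \<open>[0, \<epsilon>\<^sub>k \<parallel>z - u\<parallel>]\<close> are both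
  \<open>\<epsilon>\<^sub>k \<parallel>z - u\<parallel> / 2\<close>). If \<open>0\<close> were not in the convex hull of all the \<open>E\<^sub>k\<close> and the Clarke gradients
  of the active constraints, a strictly separating direction would decrease every centre, half-width
  and active constraint simultaneously, against quasi-minimality. The constraint qualification
  forces positive total weight on the \<open>E\<^sub>k\<close>, so the convex combination can be
  normalised.\<close>

section \<open>Real-valued parts of an interval-valued function\<close>

text \<open>Half the sum and half the difference of two functions with constant \<open>L\<close>
  again have constant \<open>L\<close>.\<close>

lemma loc_lipschitz_centre_half_width:
  assumes "loc_lipschitz_ivl f"
  shows "loc_lipschitz (\<lambda>x. centre (f x))" "loc_lipschitz (\<lambda>x. half_width (f x))"
proof -
  have "\<exists>U L. open U \<and> z \<in> U \<and> 0 < L \<and> L-lipschitz_on U (\<lambda>x. centre (f x))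
      \<and> L-lipschitz_on U (\<lambda>x. half_width (f x))" for z
  proof -
    obtain U L where U: "open U" "z \<in> U" "0 < L"
      and "\<forall>x\<in>U. \<forall>y\<in>U. max \<bar>lower (f x) - lower (f y)\<bar> \<bar>upper (f x) - upper (f y)\<bar>
             \<le> L * norm (x - y)"
      using assms unfolding loc_lipschitz_ivl_def by blast
    then have *: "\<bar>lower (f x) - lower (f y)\<bar> \<le> L * norm (x - y)"
      "\<bar>upper (f x) - upper (f y)\<bar> \<le> L * norm (x - y)" if "x \<in> U" "y \<in> U" for x y
      using that by auto
    have "\<bar>centre (f x) - centre (f y)\<bar> \<le> L * norm (x - y)" if "x \<in> U" "y \<in> U" for x y
      using *[OF that] unfolding centre_def abs_le_iff by (intro conjI; simp add: field_simps)
    moreover have "\<bar>half_width (f x) - half_width (f y)\<bar> \<le> L * norm (x - y)"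
      if "x \<in> U" "y \<in> U" for x y
      using *[OF that] unfolding half_width_def abs_le_iff by (intro conjI; simp add: field_simps)
    ultimately show ?thesis
      using U by (intro exI[of _ U] exI[of _ L]) (simp add: lipschitz_on_def dist_norm)
  qed
  then show "loc_lipschitz (\<lambda>x. centre (f x))" "loc_lipschitz (\<lambda>x. half_width (f x))"
    unfolding loc_lipschitz_def by blast+
qed

section \<open>The Clarke derivative as a joint upper limit\<close>

lemma filterlim_translate_prod:
  fixes z w :: "'a::real_normed_vector"
  shows "((\<lambda>(x, t). x + t *\<^sub>R w) \<longlongrightarrow> z) (nhds z \<times>\<^sub>F at_right (0::real))"
proof -
  have "((\<lambda>p. fst p + snd p *\<^sub>R w) \<longlongrightarrow> z + 0 *\<^sub>R w) (nhds z \<times>\<^sub>F at_right (0::real))"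
    by (intro tendsto_intros filterlim_fst filterlim_compose[OF _ filterlim_snd] tendsto_ident_at)
  then show ?thesis
    by (simp add: case_prod_unfold)
qed

lemma eventually_pos_prod_at_right:
  "\<forall>\<^sub>F p in (F \<times>\<^sub>F at_right (0::real)). 0 < snd p"
  using eventually_prodI[of "\<lambda>_. True" F "\<lambda>t. 0 < t" "at_right (0::real)"]
  by (simp add: eventually_at_right_less)

text \<open>With its counterpart \<open>clarke_deriv_leI\<close>, this trades the extended-real
  upper limit for real inequalities multiplied through by \<open>t > 0\<close>.\<close>

lemma clarke_deriv_lessD:
  assumes "clarke_deriv \<psi> z w < ereal c"
  shows "\<forall>\<^sub>F (x, t) in (nhds z \<times>\<^sub>F at_right 0). \<psi> (x + t *\<^sub>R w) - \<psi> x < c * t"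
  using Limsup_lessD[OF assms[unfolded clarke_deriv_def]] eventually_pos_prod_at_right
  by eventually_elim (auto simp: pos_divide_less_eq)

lemma clarke_deriv_leI:
  assumes "\<forall>\<^sub>F (x, t) in (nhds z \<times>\<^sub>F at_right 0). \<psi> (x + t *\<^sub>R w) - \<psi> x \<le> c * t"
  shows "clarke_deriv \<psi> z w \<le> ereal c"
  unfolding clarke_deriv_def
  by (rule Limsup_bounded, use assms eventually_pos_prod_at_right in eventually_elim)
     (auto simp: pos_divide_le_eq)

lemma descent_of_clarke_deriv_less:
  assumes "clarke_deriv \<psi> z w < ereal c"
  shows "\<forall>\<^sub>F t in at_right 0. \<psi> (z + t *\<^sub>R w) < \<psi> z + c * t"
proof -
  obtain P Q where "eventually P (nhds z)" "eventually Q (at_right 0)"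
    and *: "\<And>x t. P x \<Longrightarrow> Q t \<Longrightarrow> \<psi> (x + t *\<^sub>R w) - \<psi> x < c * t"
    using clarke_deriv_lessD[OF assms] unfolding eventually_prod_filter by auto
  \<comment> \<open>\<open>nhds z\<close> is not punctured, so the base point may be frozen at
    \<open>z\<close>.\<close>
  then have "P z" by (simp add: eventually_nhds_x_imp_x)
  show ?thesis
    using \<open>eventually Q (at_right 0)\<close> by eventually_elim (use *[OF \<open>P z\<close>] in force)
qed

text \<open>Once \<open>x\<close> and \<open>x + t *\<^sub>R w\<close> both lie in the Lipschitz
  neighbourhood, every quotient is at most \<open>L * norm w\<close> in absolute value.\<close>

lemma clarke_deriv_bounded:
  fixes \<psi> :: "'a::euclidean_space \<Rightarrow> real"
  assumes "loc_lipschitz \<psi>"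
  obtains L where "0 \<le> L" "\<And>w. \<bar>clarke_deriv \<psi> z w\<bar> \<le> ereal (L * norm w)"
proof -
  obtain U L where U: "open U" "z \<in> U" and L: "L-lipschitz_on U \<psi>"
    using assms unfolding loc_lipschitz_def by blast
  have "\<bar>clarke_deriv \<psi> z w\<bar> \<le> ereal (L * norm w)" for w
  proof -
    let ?F = "nhds z \<times>\<^sub>F at_right (0::real)"
    have "\<forall>\<^sub>F p in ?F. (case p of (x, t) \<Rightarrow> x + t *\<^sub>R w) \<in> U"
      using filterlim_translate_prod U by (rule topological_tendstoD)
    moreover have "\<forall>\<^sub>F p in ?F. fst p \<in> U"
      using eventually_prodI[of "\<lambda>x. x \<in> U" "nhds z" "\<lambda>_. True" "at_right (0::real)"] U
      by (simp add: eventually_nhds_in_open)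
    ultimately have *: "\<forall>\<^sub>F (x, t) in ?F.
        \<bar>\<psi> (x + t *\<^sub>R w) - \<psi> x\<bar> \<le> (L * norm w) * t"
      using eventually_pos_prod_at_right
    proof eventually_elim
      case (elim p)
      show ?case
        using lipschitz_on_normD[OF L, of "fst p + snd p *\<^sub>R w" "fst p"] elim
        by (auto simp: case_prod_unfold mult_ac)
    qed
    have "clarke_deriv \<psi> z w \<le> ereal (L * norm w)"
      by (rule clarke_deriv_leI) (use * in eventually_elim, auto)
    moreover have "ereal (- (L * norm w)) \<le> clarke_deriv \<psi> z w"
      unfolding clarke_deriv_def
    proof (rule le_Limsup)
      \<comment> \<open>An eventual lower bound passes to the upper limit only along a nontrivial
        filter.\<close>
      show "?F \<noteq> bot"
        by (simp add: prod_filter_eq_bot trivial_limit_at_right_real)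
      show "\<forall>\<^sub>F p in ?F. ereal (- (L * norm w))
          \<le> (case p of (x, t) \<Rightarrow> ereal ((\<psi> (x + t *\<^sub>R w) - \<psi> x) / t))"
        using * eventually_pos_prod_at_right
        by eventually_elim (auto simp: pos_le_divide_eq minus_divide_left)
    qed
    ultimately show ?thesis
      by (cases "clarke_deriv \<psi> z w") auto
  qed
  with lipschitz_on_nonneg[OF L] show thesis by (rule that)
qed

section \<open>Sublinearity and linear support\<close>

text \<open>Split the increment at \<open>x + t *\<^sub>R w'\<close>: the piece along
  \<open>w\<close> starts from this moving point, which the joint limit allows because it still
  tends to \<open>z\<close>.\<close>

lemma clarke_deriv_add_le:
  assumes "clarke_deriv \<psi> z w < ereal c" "clarke_deriv \<psi> z w' < ereal c'"
  shows "clarke_deriv \<psi> z (w + w') \<le> ereal (c + c')"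
proof (rule clarke_deriv_leI)
  let ?F = "nhds z \<times>\<^sub>F at_right (0::real)"
  have "filterlim (\<lambda>(x, t). (x + t *\<^sub>R w', t)) ?F ?F"
    using filterlim_Pair[OF filterlim_translate_prod[of w' z] filterlim_snd]
    by (simp add: case_prod_unfold)
  from eventually_compose_filterlim[OF clarke_deriv_lessD[OF assms(1)] this]
    clarke_deriv_lessD[OF assms(2)]
  show "\<forall>\<^sub>F (x, t) in ?F. \<psi> (x + t *\<^sub>R (w + w')) - \<psi> x \<le> (c + c') * t"
    by eventually_elim (auto simp: algebra_simps)
qed

text \<open>Substitute \<open>a * t\<close> for \<open>t\<close>; the step stays in
  \<open>at_right 0\<close> because \<open>a\<close> is positive.\<close>

lemma clarke_deriv_scale_le:
  assumes "0 < a" "clarke_deriv \<psi> z w < ereal c"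
  shows "clarke_deriv \<psi> z (a *\<^sub>R w) \<le> ereal (a * c)"
proof (rule clarke_deriv_leI)
  let ?F = "nhds z \<times>\<^sub>F at_right (0::real)"
  have "((\<lambda>p. a * snd p) \<longlongrightarrow> a * 0) ?F"
    by (intro tendsto_intros filterlim_compose[OF _ filterlim_snd] tendsto_ident_at)
  moreover have "\<forall>\<^sub>F p in ?F. a * snd p \<in> {0<..}"
    using eventually_pos_prod_at_right by eventually_elim (use assms in simp)
  ultimately have "filterlim (\<lambda>p. a * snd p) (at_right 0) ?F"
    by (intro tendsto_imp_filterlim_at_right) simp_all
  from filterlim_Pair[OF filterlim_fst this]
  have "filterlim (\<lambda>(x, t). (x, a * t)) ?F ?F"
    by (simp add: case_prod_unfold)
  from eventually_compose_filterlim[OF clarke_deriv_lessD[OF assms(2)] this]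
  show "\<forall>\<^sub>F (x, t) in ?F. \<psi> (x + t *\<^sub>R a *\<^sub>R w) - \<psi> x \<le> (a * c) * t"
    by eventually_elim (auto simp: algebra_simps)
qed

text \<open>A finite-dimensional Hahn-Banach theorem: separate the strict epigraph of \<open>p\<close>
  from the point \<open>(d, p d)\<close>.\<close>

lemma sublinear_support:
  fixes p :: "'a::euclidean_space \<Rightarrow> real"
  assumes add: "\<And>x y. p (x + y) \<le> p x + p y"
    and scale: "\<And>a x. 0 < a \<Longrightarrow> p (a *\<^sub>R x) = a * p x"
  obtains v where "\<And>w. v \<bullet> w \<le> p w" "v \<bullet> d = p d"
proof -
  have p0: "p 0 = 0"
    using scale[of 2 0] by simp
  define E where "E = {x. p (fst x) < snd x}"
  have "convex E"
    unfolding convex_def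
  proof (intro ballI allI impI)
    fix x y :: "'a \<times> real" and a b :: real
    assume xy: "x \<in> E" "y \<in> E" and ab: "0 \<le> a" "0 \<le> b" "a + b = 1"
    have scale0: "p (a *\<^sub>R x) = a * p x" if "0 \<le> a" for a x
      using that scale[of a x] p0 by (cases "a = 0") auto
    have "p (a *\<^sub>R fst x + b *\<^sub>R fst y) \<le> a * p (fst x) + b * p (fst y)"
      using add[of "a *\<^sub>R fst x" "b *\<^sub>R fst y"] scale0 ab by simp
    also have "\<dots> < a * snd x + b * snd y"
    \<comment> \<open>Strictness must come from a positive weight: from \<open>b = 1\<close> if
      \<open>a = 0\<close>, otherwise from \<open>a\<close>.\<close>
    proof (cases "a = 0")
      case True
      then show ?thesis using xy ab by (simp add: E_def)
    next
      case False
      then have "a * p (fst x) < a * snd x" "b * p (fst y) \<le> b * snd y"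
        using xy ab by (auto simp: E_def intro: mult_left_mono)
      then show ?thesis by linarith
    qed
    finally show "a *\<^sub>R x + b *\<^sub>R y \<in> E"
      by (simp add: E_def)
  qed
  moreover have "(0, 1) \<in> E" "(d, p d) \<notin> E"
    by (auto simp: E_def p0)
  ultimately have "\<exists>A b. A \<noteq> 0 \<and> (\<forall>x\<in>{(d, p d)}. A \<bullet> x \<le> b) \<and> (\<forall>x\<in>E. b \<le> A \<bullet> x)"
    by (intro separating_hyperplane_sets) auto
  then obtain A b where A: "A \<noteq> 0" "A \<bullet> (d, p d) \<le> b" "\<And>x. x \<in> E \<Longrightarrow> b \<le> A \<bullet> x"
    by blast
  obtain \<alpha> \<beta> where \<alpha>\<beta>: "A = (\<alpha>, \<beta>)" by (cases A)
  have sep: "\<alpha> \<bullet> d + \<beta> * p d \<le> \<alpha> \<bullet> w + \<beta> * r" if "p w < r" for w r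
    using A(2) A(3)[of "(w, r)"] that by (simp add: \<alpha>\<beta> E_def)
  \<comment> \<open>The hyperplane is not vertical: raising the height over \<open>d\<close> gives
    \<open>\<beta> \<ge> 0\<close>, and if \<open>\<beta>\<close> vanished, the test point
    \<open>d - \<alpha>\<close> would force \<open>\<alpha> = 0\<close> too.\<close>
  have "0 < \<beta>"
  proof -
    have "0 \<le> \<beta>"
      using sep[of d "p d + 1"] by (simp add: algebra_simps)
    moreover have "\<beta> \<noteq> 0"
    proof
      assume "\<beta> = 0"
      then have "\<alpha> \<bullet> d \<le> \<alpha> \<bullet> (d - \<alpha>)"
        using sep[of "d - \<alpha>" "p (d - \<alpha>) + 1"] by simp
      then have "\<alpha> \<bullet> \<alpha> \<le> 0"
        by (simp add: inner_diff_right)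
      then have "\<alpha> = 0"
        using inner_gt_zero_iff[of \<alpha>] by linarith
      then show False
        using A(1) \<open>\<beta> = 0\<close> by (simp add: \<alpha>\<beta> flip: zero_prod_def)
    qed
    ultimately show ?thesis by simp
  qed
  \<comment> \<open>Rescaled so that the hyperplane is the graph of an affine function of slope
    \<open>v\<close>; letting the height \<open>r\<close> tend to \<open>p w\<close> shows that
    \<open>p w - v \<bullet> w\<close> is least at \<open>d\<close>.\<close>
  define v where "v = - (\<alpha> /\<^sub>R \<beta>)"
  have sub: "p d - v \<bullet> d \<le> p w - v \<bullet> w" for w
  proof (rule field_le_epsilon)
    fix e :: real assume "0 < e"
    from sep[of w "p w + e"] this have "\<alpha> \<bullet> d + \<beta> * p d \<le> \<alpha> \<bullet> w + \<beta> * (p w + e)"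
      by simp
    then have "\<beta> * (p d - v \<bullet> d) \<le> \<beta> * (p w - v \<bullet> w + e)"
      using \<open>0 < \<beta>\<close> by (simp add: v_def distrib_left right_diff_distrib flip: mult.assoc)
    then show "p d - v \<bullet> d \<le> p w - v \<bullet> w + e"
      using \<open>0 < \<beta>\<close> by simp
  qed
  \<comment> \<open>By homogeneity, the test point \<open>2 *\<^sub>R d\<close> gives
    \<open>p d - v \<bullet> d \<ge> 0\<close>, and \<open>0\<close> gives the opposite
    inequality.\<close>
  have "v \<bullet> d = p d"
    using sub[of "2 *\<^sub>R d"] sub[of 0] scale[of 2 d] by (simp add: p0)
  with sub have "v \<bullet> w \<le> p w" for w
    using sub[of w] by simp
  with \<open>v \<bullet> d = p d\<close> show thesis by (rule that[rotated])
qed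

section \<open>The Clarke gradient: support function and compactness\<close>

text \<open>Linear support of the finite Clarke derivative: the functional found lies below it
  everywhere, hence belongs to the gradient, and touches it at \<open>d\<close>.\<close>

lemma clarke_grad_attains:
  fixes \<psi> :: "'a::euclidean_space \<Rightarrow> real"
  assumes "loc_lipschitz \<psi>"
  obtains v where "v \<in> clarke_grad \<psi> z" "clarke_deriv \<psi> z d = ereal (v \<bullet> d)"
proof -
  obtain L where L: "\<And>w. \<bar>clarke_deriv \<psi> z w\<bar> \<le> ereal (L * norm w)"
    using clarke_deriv_bounded[OF assms] by blast
  define p where "p w = real_of_ereal (clarke_deriv \<psi> z w)" for w
  have p: "clarke_deriv \<psi> z w = ereal (p w)" for w
    using L[of w] unfolding p_def by (cases "clarke_deriv \<psi> z w") auto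
  \<comment> \<open>The bounds for sums and multiples assume strict inequalities, so a slack is
    added and then removed.\<close>
  have "p (x + y) \<le> p x + p y" for x y
  proof (rule field_le_epsilon)
    fix e :: real assume "0 < e"
    then show "p (x + y) \<le> p x + p y + e"
      using clarke_deriv_add_le[of \<psi> z x "p x + e / 2" y "p y + e / 2"] by (simp add: p)
  qed
  moreover have le: "p (a *\<^sub>R x) \<le> a * p x" if "0 < a" for a x
  proof (rule field_le_epsilon)
    fix e :: real assume "0 < e"
    then show "p (a *\<^sub>R x) \<le> a * p x + e"
      using clarke_deriv_scale_le[OF that, of \<psi> z x "p x + e / a"] that
      by (simp add: p algebra_simps)
  qed
  have "p (a *\<^sub>R x) = a * p x" if "0 < a" for a x
    using le[OF that, of x] le[of "inverse a" "a *\<^sub>R x"] that by (simp add: field_simps)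
  ultimately obtain v where "\<And>w. v \<bullet> w \<le> p w" "v \<bullet> d = p d"
    using sublinear_support[of p d] by blast
  then show thesis
    by (intro that[of v]) (auto simp: clarke_grad_def p)
qed

lemma clarke_grad_nonempty: "loc_lipschitz \<psi> \<Longrightarrow> clarke_grad \<psi> z \<noteq> {}"
  by (metis clarke_grad_attains empty_iff)

text \<open>Convexity and closedness are inherited from preimages of rays under linear functionals;
  where the derivative is infinite, the ray becomes the whole line or the empty set.\<close>

lemma clarke_grad_eq_INT:
  "clarke_grad \<psi> z = (\<Inter>w. (\<lambda>v. v \<bullet> w) -` {r. ereal r \<le> clarke_deriv \<psi> z w})"
  by (auto simp: clarke_grad_def)

lemma convex_clarke_grad: "convex (clarke_grad \<psi> z)"
proof -
  have "convex {r. ereal r \<le> c}" for c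
    by (cases c) (auto simp: atMost_def[symmetric])
  then show ?thesis
    unfolding clarke_grad_eq_INT
    by (intro convex_INT convex_linear_vimage bounded_linear.linear bounded_linear_inner_left)
qed

lemma closed_clarke_grad: "closed (clarke_grad \<psi> z)"
proof -
  have "closed {r. ereal r \<le> c}" for c
    by (cases c) (auto simp: atMost_def[symmetric])
  then show ?thesis
    unfolding clarke_grad_eq_INT by (intro closed_INT ballI closed_vimage continuous_intros)
qed

text \<open>Boundedness comes from testing \<open>v\<close> in its own direction: the square of
  \<open>norm v\<close> is at most \<open>L * norm v\<close>.\<close>

lemma compact_clarke_grad:
  fixes \<psi> :: "'a::euclidean_space \<Rightarrow> real"
  assumes "loc_lipschitz \<psi>"
  shows "compact (clarke_grad \<psi> z)"
proof -
  obtain L where L: "0 \<le> L" "\<And>w. \<bar>clarke_deriv \<psi> z w\<bar> \<le> ereal (L * norm w)"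
    using clarke_deriv_bounded[OF assms] by blast
  have "norm v \<le> L" if "v \<in> clarke_grad \<psi> z" for v
  proof (cases "v = 0")
    case True
    then show ?thesis using L(1) by simp
  next
    case False
    have "ereal (v \<bullet> v) \<le> clarke_deriv \<psi> z v"
      using that by (simp add: clarke_grad_def)
    also have "\<dots> \<le> ereal (L * norm v)"
      using L(2)[of v] by (cases "clarke_deriv \<psi> z v") auto
    finally show ?thesis
      using False by (simp add: dot_square_norm power2_eq_square)
  qed
  then show ?thesis
    using closed_clarke_grad by (auto simp: compact_eq_bounded_closed bounded_iff)
qed

section \<open>A theorem of the alternative and Minkowski sums\<close>

text \<open>A Gordan-type alternative. The hull of finitely many compact sets is compact, so if it
  misses \<open>0\<close>, a hyperplane strictly separates the two and its reversed normal is a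
  common descent direction.\<close>

lemma zero_convex_combination_or_descent:
  fixes C :: "'i \<Rightarrow> 'a::euclidean_space set"
  assumes "finite I" "\<And>i. i \<in> I \<Longrightarrow> convex (C i)" "\<And>i. i \<in> I \<Longrightarrow> compact (C i)"
    "\<And>i. i \<in> I \<Longrightarrow> C i \<noteq> {}"
    and no_descent: "\<nexists>d. \<forall>i\<in>I. \<forall>x\<in>C i. x \<bullet> d < 0"
  obtains c s where "\<And>i. i \<in> I \<Longrightarrow> 0 \<le> c i" "sum c I = 1" "\<And>i. i \<in> I \<Longrightarrow> s i \<in> C i"
    "(\<Sum>i\<in>I. c i *\<^sub>R s i) = 0"
proof -
  let ?D = "convex hull (\<Union>(C ` I))"
  have "0 \<in> ?D"
  proof (rule ccontr)
    assume "0 \<notin> ?D"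
    moreover have "closed ?D"
      using assms by (intro compact_imp_closed compact_convex_hull compact_UN) auto
    ultimately obtain a b where "0 < b" "\<forall>x\<in>?D. b < a \<bullet> x"
      using separating_hyperplane_closed_0[of ?D] by auto
    then have "x \<bullet> (- a) < 0" if "i \<in> I" "x \<in> C i" for i x
      using that hull_inc[of x "\<Union>(C ` I)" convex] by (fastforce simp: inner_commute)
    then show False using no_descent by blast
  qed
  \<comment> \<open>Convexity of each \<open>C i\<close> merges its points into one, so a single
    weight and point per index suffice.\<close>
  also have "?D = {sum (\<lambda>i. c i *\<^sub>R s i) I | c s.
      (\<forall>i\<in>I. c i \<ge> 0) \<and> sum c I = 1 \<and> (\<forall>i\<in>I. s i \<in> C i)}"
    using assms by (intro convex_hull_finite_union) auto
  finally obtain c s where "(\<Sum>i\<in>I. c i *\<^sub>R s i) = 0" "\<forall>i\<in>I. c i \<ge> 0" "sum c I = 1"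
    "\<forall>i\<in>I. s i \<in> C i"
    by auto
  then show thesis by (intro that[of c s]) auto
qed

lemma sum_in_sum_set:
  fixes A :: "'i \<Rightarrow> 'a::comm_monoid_add set"
  assumes "\<And>i. i \<in> I \<Longrightarrow> s i \<in> A i"
  shows "sum s I \<in> (\<Sum>i\<in>I. A i)"
  using assms by (induction I rule: infinite_finite_induct) auto

lemma scale_set_memI: "x \<in> A \<Longrightarrow> c *\<^sub>R x \<in> c *\<^sub>S A"
  unfolding scale_set_def by (rule imageI)

lemma mem_scale_unit_cball:
  assumes "norm x \<le> r"
  shows "x \<in> r *\<^sub>S cball 0 1"
proof (cases "r = 0")
  case True
  then show ?thesis using assms scale_set_memI[of 0 "cball 0 1" 0] by simp
next
  case False
  then have "0 < r" using assms norm_ge_zero[of x] by linarith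
  then show ?thesis
    using assms scale_set_memI[of "x /\<^sub>R r" "cball 0 1" r] by (simp add: field_simps)
qed

section \<open>The weakly generalized gradient and its thickening\<close>

lemma compact_weak_gen_grad:
  assumes "loc_lipschitz_ivl f"
  shows "compact (weak_gen_grad f z)"
  unfolding weak_gen_grad_def
  by (intro compact_convex_hull compact_Un compact_clarke_grad loc_lipschitz_centre_half_width assms)

lemma weak_gen_grad_supset:
  "clarke_grad (\<lambda>x. centre (f x)) z \<subseteq> weak_gen_grad f z"
  "clarke_grad (\<lambda>x. half_width (f x)) z \<subseteq> weak_gen_grad f z"
  unfolding weak_gen_grad_def by (meson Un_subset_iff hull_subset)+

lemma weak_gen_grad_nonempty:
  assumes "loc_lipschitz_ivl f"
  shows "weak_gen_grad f z \<noteq> {}"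
  using clarke_grad_nonempty[OF loc_lipschitz_centre_half_width(1)[OF assms]]
    weak_gen_grad_supset(1) by blast

text \<open>The ball \<open>r \<cdot> B\<close> contributes its support function \<open>r * norm d\<close>.\<close>

lemma clarke_deriv_less_of_ball_thickening:
  fixes \<psi> :: "'a::euclidean_space \<Rightarrow> real"
  assumes "loc_lipschitz \<psi>" "clarke_grad \<psi> z \<subseteq> A" "0 \<le> r"
    and neg: "\<And>x. x \<in> A + cball 0 r \<Longrightarrow> x \<bullet> d < 0"
  shows "clarke_deriv \<psi> z d < ereal (- (r * norm d))"
proof -
  obtain v where v: "v \<in> clarke_grad \<psi> z" "clarke_deriv \<psi> z d = ereal (v \<bullet> d)"
    using clarke_grad_attains[OF assms(1)] by blast
  \<comment> \<open>A point of the ball with the largest inner product with \<open>d\<close>; using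
    \<open>sgn\<close> also covers \<open>d = 0\<close>.\<close>
  have "(r *\<^sub>R sgn d) \<in> cball 0 r"
    using assms(3) by (simp add: norm_sgn)
  then have "(v + r *\<^sub>R sgn d) \<bullet> d < 0"
    using v assms(2) by (intro neg set_plus_intro) auto
  moreover have "sgn d \<bullet> d = norm d"
    by (cases "d = 0") (simp_all add: sgn_div_norm dot_square_norm power2_eq_square)
  ultimately show ?thesis
    by (simp add: v inner_add_left)
qed

section \<open>Exclusion of common descent directions\<close>

text \<open>For small \<open>t > 0\<close> the point \<open>u + t *\<^sub>R d\<close> would be
  feasible and strictly better. The ball of radius \<open>\<epsilon> k / 2\<close> makes centre and
  half-width each fall by more than \<open>\<epsilon> k / 2 * norm d * t\<close>, exactly what the
  penalty interval adds to each.\<close>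

lemma no_descent_direction:
  fixes u d :: "'a::euclidean_space"
  assumes fin: "finite K" "finite J"
    and F: "\<And>k. k \<in> K \<Longrightarrow> loc_lipschitz_ivl (F k)"
    and g: "\<And>j. j \<in> J \<Longrightarrow> loc_lipschitz (g j)"
    and \<epsilon>: "\<And>k. k \<in> K \<Longrightarrow> 0 \<le> \<epsilon> k"
    and u: "u \<in> weak_quasi_minimal K F (feasible_set J g) \<epsilon>"
    and dF: "\<And>k x. k \<in> K \<Longrightarrow> x \<in> weak_gen_grad (F k) u + cball 0 (\<epsilon> k / 2) \<Longrightarrow> x \<bullet> d < 0"
    and dg: "\<And>j x. j \<in> active_set J g u \<Longrightarrow> x \<in> clarke_grad (g j) u \<Longrightarrow> x \<bullet> d < 0"
  shows False
proof -
  have "\<forall>\<^sub>F t in at_right 0. F k (u + t *\<^sub>R d) + Interval (0, \<epsilon> k * norm (u + t *\<^sub>R d - u)) \<prec>\<^sub>C\<^sub>W F k u"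
    if k: "k \<in> K" for k
  proof -
    note lip = loc_lipschitz_centre_half_width[OF F[OF k]]
    have "\<forall>\<^sub>F t in at_right 0.
        centre (F k (u + t *\<^sub>R d)) < centre (F k u) + - (\<epsilon> k / 2 * norm d) * t"
      using lip(1) weak_gen_grad_supset(1)[of "F k" u] \<epsilon>[OF k] dF[OF k]
      by (intro descent_of_clarke_deriv_less
          clarke_deriv_less_of_ball_thickening[where A = "weak_gen_grad (F k) u"]) auto
    moreover have "\<forall>\<^sub>F t in at_right 0.
        half_width (F k (u + t *\<^sub>R d)) < half_width (F k u) + - (\<epsilon> k / 2 * norm d) * t"
      using lip(2) weak_gen_grad_supset(2)[of "F k" u] \<epsilon>[OF k] dF[OF k]
      by (intro descent_of_clarke_deriv_less
          clarke_deriv_less_of_ball_thickening[where A = "weak_gen_grad (F k) u"]) auto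
    ultimately show ?thesis
      using eventually_at_right_less[of 0]
    proof eventually_elim
      case (elim t)
      \<comment> \<open>\<open>Interval (0, r)\<close> has the intended endpoints only for
        \<open>r \<ge> 0\<close>.\<close>
      then have "0 \<le> \<epsilon> k * (t * norm d)"
        using \<epsilon>[OF k] by simp
      then have "lower (Interval (0, \<epsilon> k * (t * norm d))) = 0"
        "upper (Interval (0, \<epsilon> k * (t * norm d))) = \<epsilon> k * (t * norm d)"
        by (simp_all add: lower.rep_eq upper.rep_eq Interval_inverse)
      with elim show ?case
        by (simp add: cw_less_def centre_def half_width_def field_simps)
    qed
  qed
  then have objective: "\<forall>\<^sub>F t in at_right 0. \<forall>k\<in>K.
      F k (u + t *\<^sub>R d) + Interval (0, \<epsilon> k * norm (u + t *\<^sub>R d - u)) \<prec>\<^sub>C\<^sub>W F k u"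
    using fin by (simp add: eventually_ball_finite)
  have feas: "u \<in> feasible_set J g"
    using u by (simp add: weak_quasi_minimal_def)
  have "\<forall>\<^sub>F t in at_right 0. g j (u + t *\<^sub>R d) \<le> 0" if j: "j \<in> J" for j
  \<comment> \<open>Active constraints decrease to first order along \<open>d\<close>; inactive ones
    stay negative by continuity.\<close>
  proof (cases "g j u = 0")
    case True
    obtain v where "v \<in> clarke_grad (g j) u" "clarke_deriv (g j) u d = ereal (v \<bullet> d)"
      using clarke_grad_attains[OF g[OF j]] by blast
    then have "clarke_deriv (g j) u d < ereal 0"
      using dg[of j v] j True by (simp add: active_set_def)
    from descent_of_clarke_deriv_less[OF this] show ?thesis
      by eventually_elim (use True in simp)
  next
    case False
    then have "g j u < 0"
      using feas j by (force simp: feasible_set_def)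
    obtain U L where "open U" "u \<in> U" "L-lipschitz_on U (g j)"
      using g[OF j] unfolding loc_lipschitz_def by blast
    then have "isCont (g j) u"
      using lipschitz_on_continuous_on continuous_on_eq_continuous_at by blast
    moreover have "((\<lambda>t. u + t *\<^sub>R d) \<longlongrightarrow> u + 0 *\<^sub>R d) (at_right 0)"
      by (intro tendsto_intros)
    ultimately have "((\<lambda>t. g j (u + t *\<^sub>R d)) \<longlongrightarrow> g j u) (at_right 0)"
      using isCont_tendsto_compose[of u "g j"] by simp
    from order_tendstoD(2)[OF this \<open>g j u < 0\<close>] show ?thesis
      by eventually_elim simp
  qed
  then have "\<forall>\<^sub>F t in at_right 0. \<forall>j\<in>J. g j (u + t *\<^sub>R d) \<le> 0"
    using fin by (simp add: eventually_ball_finite)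
  \<comment> \<open>Eventual conditions along a nontrivial filter share one
    \<open>t\<close>.\<close>
  with objective obtain t where "\<forall>j\<in>J. g j (u + t *\<^sub>R d) \<le> 0" "\<forall>k\<in>K.
      F k (u + t *\<^sub>R d) + Interval (0, \<epsilon> k * norm (u + t *\<^sub>R d - u)) \<prec>\<^sub>C\<^sub>W F k u"
    using eventually_happens'[OF trivial_limit_at_right_real eventually_conj] by blast
  then show False
    using u unfolding weak_quasi_minimal_def feasible_set_def by blast
qed

section \<open>Multipliers and their normalisation\<close>

text \<open>The theorem of the alternative gives a Fritz John combination; \<open>BCQ\<close> then
  rules out zero total weight on the objectives.\<close>

lemma weak_quasi_minimal_multipliers:
  fixes F :: "nat \<Rightarrow> 'a::euclidean_space \<Rightarrow> real interval" and u :: 'a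
  assumes fin: "finite K" "finite J"
    and F: "\<And>k. k \<in> K \<Longrightarrow> loc_lipschitz_ivl (F k)"
    and g: "\<And>j. j \<in> J \<Longrightarrow> loc_lipschitz (g j)"
    and \<epsilon>: "\<And>k. k \<in> K \<Longrightarrow> 0 \<le> \<epsilon> k"
    and u: "u \<in> weak_quasi_minimal K F (feasible_set J g) \<epsilon>"
    and bcq: "BCQ J g u"
  obtains l \<mu> :: "nat \<Rightarrow> real"
  where "\<And>k. k \<in> K \<Longrightarrow> 0 \<le> l k" "sum l K = 1" "\<And>j. j \<in> J \<Longrightarrow> 0 \<le> \<mu> j"
    "0 \<in> (\<Sum>k\<in>K. l k *\<^sub>S weak_gen_grad (F k) u)
         + (\<Sum>j\<in>active_set J g u. \<mu> j *\<^sub>S clarke_grad (g j) u)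
         + (\<Sum>k\<in>K. (l k * \<epsilon> k) *\<^sub>S cball 0 1)"
    "\<And>j. j \<in> J \<Longrightarrow> \<mu> j * g j u = 0"
proof -
  let ?A = "active_set J g u"
  let ?W = "\<lambda>k. weak_gen_grad (F k) u" and ?G = "\<lambda>j. clarke_grad (g j) u"
  have A: "finite ?A" "?A \<subseteq> J"
    using fin by (auto simp: active_set_def)
  \<comment> \<open>The disjoint sum keeps objective and constraint indices apart, both being
    naturals.\<close>
  define C where "C = case_sum (\<lambda>k. ?W k + cball 0 (\<epsilon> k / 2)) ?G"
  have "convex (C i) \<and> compact (C i) \<and> C i \<noteq> {}" if "i \<in> K <+> ?A" for i
    using that
  proof (cases i)
    case (Inl k)
    then have k: "k \<in> K" using that by auto
    let ?B = "cball (0::'a) (\<epsilon> k / 2)"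
    have "convex (?W k + ?B)"
      by (simp add: weak_gen_grad_def convex_set_plus)
    moreover have sum_eq: "?W k + ?B = {x + y |x y. x \<in> ?W k \<and> y \<in> ?B}"
      unfolding set_plus_def by blast
    have "compact (?W k + ?B)"
      unfolding sum_eq by (intro compact_sums compact_weak_gen_grad F k compact_cball)
    moreover obtain x where "x \<in> ?W k"
      using weak_gen_grad_nonempty[OF F[OF k]] by blast
    then have "x + 0 \<in> ?W k + ?B"
      using \<epsilon>[OF k] by (intro set_plus_intro) auto
    then have "?W k + ?B \<noteq> {}"
      by blast
    ultimately show ?thesis
      unfolding C_def Inl sum.case by blast
  next
    case (Inr j)
    then have "loc_lipschitz (g j)"
      using that A(2) g by auto
    then show ?thesis
      by (simp add: C_def Inr convex_clarke_grad compact_clarke_grad clarke_grad_nonempty)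
  qed
  moreover have "\<nexists>d. \<forall>i \<in> K <+> ?A. \<forall>x\<in>C i. x \<bullet> d < 0"
  proof
    assume "\<exists>d. \<forall>i \<in> K <+> ?A. \<forall>x\<in>C i. x \<bullet> d < 0"
    then obtain d where d: "\<And>i x. i \<in> K <+> ?A \<Longrightarrow> x \<in> C i \<Longrightarrow> x \<bullet> d < 0"
      by blast
    show False
    proof (rule no_descent_direction[of K J F g \<epsilon> u d])
      show "x \<bullet> d < 0" if "k \<in> K" "x \<in> ?W k + cball 0 (\<epsilon> k / 2)" for k x
        using d[of "Inl k" x] that InlI[of k K ?A] by (simp add: C_def)
      show "x \<bullet> d < 0" if "j \<in> ?A" "x \<in> ?G j" for j x
        using d[of "Inr j" x] that InrI[of j ?A K] by (simp add: C_def)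
    qed (use assms in auto)
  qed
  moreover have "finite (K <+> ?A)"
    using A fin by simp
  ultimately obtain c s where c: "\<And>i. i \<in> K <+> ?A \<Longrightarrow> 0 \<le> c i" "sum c (K <+> ?A) = 1"
    and s: "\<And>i. i \<in> K <+> ?A \<Longrightarrow> s i \<in> C i" and zero: "(\<Sum>i\<in>K <+> ?A. c i *\<^sub>R s i) = 0"
    using zero_convex_combination_or_descent[of "K <+> ?A" C] by blast
  \<comment> \<open>Extending \<open>b\<close> by zero to inactive indices yields complementarity
    and the form of multiplier that \<open>BCQ\<close> speaks about.\<close>
  define a b where "a k = c (Inl k)" and "b j = (if j \<in> ?A then c (Inr j) else 0)" for k j
  have a: "0 \<le> a k" if "k \<in> K" for k
    unfolding a_def by (intro c(1) InlI that)
  have b: "0 \<le> b j" for j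
    using c(1)[OF InrI] by (simp add: b_def)
  have sum_ab: "sum a K + sum b ?A = 1"
    using c(2) A fin by (simp add: sum.Plus a_def b_def)
  have "\<forall>k\<in>K. \<exists>x e. x \<in> ?W k \<and> norm e \<le> \<epsilon> k / 2 \<and> s (Inl k) = x + e"
  proof
    fix k assume "k \<in> K"
    then show "\<exists>x e. x \<in> ?W k \<and> norm e \<le> \<epsilon> k / 2 \<and> s (Inl k) = x + e"
      using s[OF InlI, of k] by (fastforce simp: C_def set_plus_def)
  qed
  then obtain x e where x: "\<And>k. k \<in> K \<Longrightarrow> x k \<in> ?W k"
    and e: "\<And>k. k \<in> K \<Longrightarrow> norm (e k) \<le> \<epsilon> k / 2"
    and xe: "\<And>k. k \<in> K \<Longrightarrow> s (Inl k) = x k + e k"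
    by metis
  define y where "y j = s (Inr j)" for j
  have y: "y j \<in> ?G j" if "j \<in> ?A" for j
    using s[OF InrI[OF that]] by (simp add: C_def y_def)
  have "(\<Sum>k\<in>K. c (Inl k) *\<^sub>R s (Inl k)) = (\<Sum>k\<in>K. a k *\<^sub>R (x k + e k))"
    by (intro sum.cong) (simp_all only: a_def xe)
  then have zero': "(\<Sum>k\<in>K. a k *\<^sub>R (x k + e k)) + (\<Sum>j\<in>?A. b j *\<^sub>R y j) = 0"
    using zero A fin by (simp add: sum.Plus b_def y_def)
  define \<sigma> where "\<sigma> = sum a K"
  have "0 \<le> \<sigma>"
    unfolding \<sigma>_def by (intro sum_nonneg a)
  moreover have "\<sigma> \<noteq> 0"
  proof
    assume "\<sigma> = 0"
    then have "a k = 0" if "k \<in> K" for k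
      using sum_nonneg_0[OF fin(1) a] that by (simp add: \<sigma>_def)
    then have "(\<Sum>j\<in>?A. b j *\<^sub>R y j) = 0"
      using zero' by simp
    \<comment> \<open>\<open>BCQ\<close> sums over all of \<open>J\<close>, so every index needs a
      member of its gradient; at an inactive index any member will do, as its weight is
      zero.\<close>
    define y' where "y' j = (if j \<in> ?A then y j else (SOME v. v \<in> ?G j))" for j
    have "y' j \<in> ?G j" if "j \<in> J" for j
      using y clarke_grad_nonempty[OF g[OF that], of u]
      by (auto simp: y'_def some_in_eq)
    then have "(\<Sum>j\<in>J. b j *\<^sub>R y' j) \<in> (\<Sum>j\<in>J. b j *\<^sub>S ?G j)"
      by (intro sum_in_sum_set scale_set_memI) auto
    moreover have "(\<Sum>j\<in>J. b j *\<^sub>R y' j) = (\<Sum>j\<in>?A. b j *\<^sub>R y j)"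
      using A fin by (intro sum.mono_neutral_cong_right) (auto simp: b_def y'_def)
    ultimately have "0 \<in> (\<Sum>j\<in>J. b j *\<^sub>S ?G j)"
      using \<open>(\<Sum>j\<in>?A. b j *\<^sub>R y j) = 0\<close> by simp
    \<comment> \<open>With \<open>\<sigma> = 0\<close> the constraint weights sum to 1, so they
      cannot all vanish.\<close>
    moreover have "\<exists>j\<in>J. b j \<noteq> 0"
    proof (rule ccontr)
      assume "\<not> (\<exists>j\<in>J. b j \<noteq> 0)"
      then have "sum b ?A = 0"
        using A(2) by (intro sum.neutral) blast
      then show False
        using sum_ab \<open>\<sigma> = 0\<close> by (simp add: \<sigma>_def)
    qed
    moreover have "\<forall>j\<in>J - ?A. b j = 0"
      by (simp add: b_def)
    ultimately show False
      using bcq b unfolding BCQ_def by blast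
  qed
  ultimately have "0 < \<sigma>" by simp
  define l \<mu> where "l k = a k / \<sigma>" and "\<mu> j = b j / \<sigma>" for k j
  have l: "0 \<le> l k" if "k \<in> K" for k
    using a[OF that] \<open>0 < \<sigma>\<close> by (simp add: l_def)
  have "sum l K = 1"
    using \<open>0 < \<sigma>\<close> by (simp add: l_def \<sigma>_def flip: sum_divide_distrib)
  have "(\<Sum>k\<in>K. l k *\<^sub>R x k) + (\<Sum>j\<in>?A. \<mu> j *\<^sub>R y j) + (\<Sum>k\<in>K. l k *\<^sub>R e k)
      = inverse \<sigma> *\<^sub>R ((\<Sum>k\<in>K. a k *\<^sub>R (x k + e k)) + (\<Sum>j\<in>?A. b j *\<^sub>R y j))"
    by (simp add: l_def \<mu>_def scaleR_sum_right scaleR_add_right sum.distrib divide_inverse mult_ac)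
  then have "0 = (\<Sum>k\<in>K. l k *\<^sub>R x k) + (\<Sum>j\<in>?A. \<mu> j *\<^sub>R y j) + (\<Sum>k\<in>K. l k *\<^sub>R e k)"
    by (simp add: zero')
  also have "\<dots> \<in> (\<Sum>k\<in>K. l k *\<^sub>S ?W k) + (\<Sum>j\<in>?A. \<mu> j *\<^sub>S ?G j)
      + (\<Sum>k\<in>K. (l k * \<epsilon> k) *\<^sub>S cball 0 1)"
  proof (intro set_plus_intro sum_in_sum_set)
    show "l k *\<^sub>R e k \<in> (l k * \<epsilon> k) *\<^sub>S cball 0 1" if "k \<in> K" for k
    proof (rule mem_scale_unit_cball)
      \<comment> \<open>The argument yields radius \<open>\<epsilon> k / 2\<close>, relaxed here to
        the radius \<open>\<epsilon> k\<close> of the claim.\<close>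
      have "norm (e k) \<le> \<epsilon> k"
        using e[OF that] \<epsilon>[OF that] by simp
      then show "norm (l k *\<^sub>R e k) \<le> l k * \<epsilon> k"
        using l[OF that] by (simp add: mult_left_mono)
    qed
  qed (use x y in \<open>auto intro: scale_set_memI\<close>)
  finally have "0 \<in> (\<Sum>k\<in>K. l k *\<^sub>S ?W k) + (\<Sum>j\<in>?A. \<mu> j *\<^sub>S ?G j)
      + (\<Sum>k\<in>K. (l k * \<epsilon> k) *\<^sub>S cball 0 1)" .
  moreover have "0 \<le> \<mu> j" "\<mu> j * g j u = 0" for j
    using b \<open>0 < \<sigma>\<close> by (auto simp: \<mu>_def b_def active_set_def)
  ultimately show thesis
    using that l \<open>sum l K = 1\<close> by blast
qed

theorem corollary4p1:
  fixes m p :: nat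
    and F :: "nat \<Rightarrow> real ^ 'n \<Rightarrow> real interval"
    and g :: "nat \<Rightarrow> real ^ 'n \<Rightarrow> real"
    and \<epsilon> :: "nat \<Rightarrow> real"
    and u :: "real ^ 'n"
  assumes "\<And>k. k \<in> {1..m} \<Longrightarrow> loc_lipschitz_ivl (F k)"
    and "\<And>j. j \<in> {1..p} \<Longrightarrow> loc_lipschitz (g j)"
    and "\<And>k. k \<in> {1..m} \<Longrightarrow> 0 \<le> \<epsilon> k"
    and "\<exists>k\<in>{1..m}. \<epsilon> k \<noteq> 0"
    and "u \<in> weak_quasi_minimal {1..m} F (feasible_set {1..p} g) \<epsilon>"
    and "BCQ {1..p} g u"
  shows "\<exists>l \<mu> :: nat \<Rightarrow> real.
           (\<forall>k\<in>{1..m}. 0 \<le> l k) \<and> (\<Sum>k\<in>{1..m}. l k) = 1 \<and> (\<forall>j\<in>{1..p}. 0 \<le> \<mu> j) \<and>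
           0 \<in> (\<Sum>k\<in>{1..m}. l k *\<^sub>S weak_gen_grad (F k) u)
               + (\<Sum>j\<in>active_set {1..p} g u. \<mu> j *\<^sub>S clarke_grad (g j) u)
               + (\<Sum>k\<in>{1..m}. (l k * \<epsilon> k) *\<^sub>S cball 0 1) \<and>
           (\<forall>j\<in>{1..p}. \<mu> j * g j u = 0)"
  by (rule weak_quasi_minimal_multipliers
      [OF finite_atLeastAtMost finite_atLeastAtMost assms(1) assms(2) assms(3) assms(5) assms(6)])
     blast+

end
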